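(* Every arborescence of order $n$ with $k$ leaves is $(n+k-1)$-unavoidable.
   Context: A tournament is an orientation of a complete graph. A digraph $D$ is $m$-unavoidable if every tournament of order $m$ contains $D$ as a subdigraph. An oriented tree is an orientation of a tree. An out-arborescence (resp. in-arborescence) is an oriented tree in which all arcs are oriented away from (resp. towards) a fixed vertex, the root; an arborescence is either an in-arborescence or an out-arborescence. A leaf of an oriented tree is a vertex adjacent to at most one vertex. *)

theory Defs
  imports "Graph_Theory.Graph_Theory"
begin

text \<open>
  An undirected simple graph is a finite, loop-free, symmetric digraph without parallel arcs
  (\<^locale>\<open>pair_graph\<close>). The underlying graph of a digraph is given by \<^const>\<open>mk_symmetric\<close>.
\<close>

definition orientation :: "'a pair_pre_digraph \<Rightarrow> 'a pair_pre_digraph \<Rightarrow> bool" where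
  "orientation D G \<longleftrightarrow> pair_graph G \<and> pair_digraph D \<and>
     parcs D \<inter> (parcs D)\<inverse> = {} \<and> mk_symmetric (with_proj D) = G"

definition tournament :: "nat \<Rightarrow> 'a pair_pre_digraph \<Rightarrow> bool" where
  "tournament m T \<longleftrightarrow> (\<exists>G. complete_digraph m (with_proj G) \<and> orientation T G)"

definition contains_subdigraph :: "'a pair_pre_digraph \<Rightarrow> 'b pair_pre_digraph \<Rightarrow> bool" where
  "contains_subdigraph T D \<longleftrightarrow>
     (\<exists>H. subgraph H (with_proj T) \<and> digraph_iso (with_proj D) H)"

text \<open>
  A definition cannot quantify over types, so the vertex type of the tournaments is a parameter.
  A theorem that is polymorphic in it covers tournaments on arbitrary vertex types.
\<close>

definition unavoidable :: "'t itself \<Rightarrow> nat \<Rightarrow> 'a pair_pre_digraph \<Rightarrow> bool" where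
  "unavoidable _ m D \<longleftrightarrow>
     (\<forall>T :: 't pair_pre_digraph. tournament m T \<longrightarrow> contains_subdigraph T D)"

text \<open>
  The predicate \<^const>\<open>tree\<close> is not suitable here: in a symmetric digraph it counts
  \<open>u, v, u\<close> as a cycle, and in an oriented graph it only sees directed cycles.
  The cycles of an undirected graph are the cycles of length at least 3 of the corresponding
  symmetric digraph. Connected digraphs are nonempty.
\<close>

definition undirected_tree :: "'a pair_pre_digraph \<Rightarrow> bool" where
  "undirected_tree G \<longleftrightarrow> pair_graph G \<and> connected (with_proj G) \<and>
     \<not> (\<exists>p. pre_digraph.cycle (with_proj G) p \<and> length p \<ge> 3)"

definition oriented_tree :: "'a pair_pre_digraph \<Rightarrow> bool" where
  "oriented_tree D \<longleftrightarrow> (\<exists>G. undirected_tree G \<and> orientation D G)"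

text \<open>
  An arc \<open>(u, v)\<close> is oriented away from \<open>r\<close> if the path from \<open>r\<close> to \<open>v\<close> in the underlying tree
  traverses the edge from \<open>u\<close> to \<open>v\<close>, and towards \<open>r\<close> if the path from \<open>u\<close> to \<open>r\<close> in the
  underlying tree does.
\<close>

definition oriented_away :: "'a pair_pre_digraph \<Rightarrow> 'a \<Rightarrow> 'a \<times> 'a \<Rightarrow> bool" where
  "oriented_away D r e \<longleftrightarrow>
     (\<exists>p. pre_digraph.apath (with_proj (mk_symmetric (with_proj D))) r p (snd e) \<and> e \<in> set p)"

definition oriented_towards :: "'a pair_pre_digraph \<Rightarrow> 'a \<Rightarrow> 'a \<times> 'a \<Rightarrow> bool" where
  "oriented_towards D r e \<longleftrightarrow>
     (\<exists>p. pre_digraph.apath (with_proj (mk_symmetric (with_proj D))) (fst e) p r \<and> e \<in> set p)"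

definition out_arborescence :: "'a pair_pre_digraph \<Rightarrow> bool" where
  "out_arborescence D \<longleftrightarrow> oriented_tree D \<and>
     (\<exists>r \<in> pverts D. \<forall>e \<in> parcs D. oriented_away D r e)"

definition in_arborescence :: "'a pair_pre_digraph \<Rightarrow> bool" where
  "in_arborescence D \<longleftrightarrow> oriented_tree D \<and>
     (\<exists>r \<in> pverts D. \<forall>e \<in> parcs D. oriented_towards D r e)"

definition arborescence :: "'a pair_pre_digraph \<Rightarrow> bool" where
  "arborescence D \<longleftrightarrow> in_arborescence D \<or> out_arborescence D"

definition leaves :: "'a pair_pre_digraph \<Rightarrow> 'a set" where
  "leaves D = {v \<in> pverts D. card {u. (v, u) \<in> parcs (mk_symmetric (with_proj D))} \<le> 1}"

end

theory Submission
  imports Defs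
begin

text \<open>
  Order the tournament so that the number of forward arcs is maximal (a median order), and embed an
  out-arborescence greedily: the root goes to the first vertex, and going through the order, the
  children of a node embedded at \<open>v\<close> are put on the first out-neighbours of \<open>v\<close> after \<open>v\<close> that are
  still free. If a vertex \<open>i\<close> stays free, let \<open>j < i\<close> be the last position of a node that has a
  child not embedded up to \<open>i\<close>. The out-neighbours of \<open>j\<close> in \<open>(j, i]\<close> were all taken when \<open>j\<close> was
  processed, so the free vertices in \<open>(j, i]\<close> are in-neighbours of \<open>j\<close>, and the median order has at
  least as many out-neighbours there. These carry roots of disjoint complete subtrees embedded in
  \<open>(j, i]\<close>, each of which has a sink. Hence there are at most as many free vertices
  as embedded sinks. In-arborescences follow by reversing all arcs.
\<close>

section \<open>Median orders\<close>

fun forward_arcs :: "'a rel \<Rightarrow> 'a list \<Rightarrow> nat" where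
  "forward_arcs A [] = 0"
| "forward_arcs A (x # xs) = length (filter (\<lambda>y. (x, y) \<in> A) xs) + forward_arcs A xs"

text \<open>Moving \<open>x\<close> behind the block \<open>Q\<close> affects only the arcs between
  \<open>x\<close> and \<open>Q\<close>. The additive form avoids subtraction of naturals.\<close>

lemma forward_arcs_move:
  "forward_arcs A (P @ x # Q @ R) + length (filter (\<lambda>y. (y, x) \<in> A) Q)
    = forward_arcs A (P @ Q @ x # R) + length (filter (\<lambda>y. (x, y) \<in> A) Q)"
proof (induction P)
  case Nil
  show ?case by (induction Q) auto
qed simp

text \<open>Vertices are replaced by their positions in the order. \<open>median\<close> is what
  maximality yields: moving position \<open>j\<close> to just behind \<open>i\<close> gains no
  forward arcs.\<close>

locale median_tournament =
  fixes m :: nat and T :: "nat \<Rightarrow> nat \<Rightarrow> bool"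
  assumes total: "i < m \<Longrightarrow> j < m \<Longrightarrow> i \<noteq> j \<Longrightarrow> T i j \<or> T j i"
    and median: "i < m \<Longrightarrow>
      card {l \<in> {j<..i}. T l j} \<le> card {l \<in> {j<..i}. T j l}"

lemma obtain_median_order:
  assumes "finite W" "card W = m"
    and total: "\<And>x y. x \<in> W \<Longrightarrow> y \<in> W \<Longrightarrow> x \<noteq> y \<Longrightarrow> (x, y) \<in> A \<or> (y, x) \<in> A"
  obtains f where "bij_betw f {..<m} W" "median_tournament m (\<lambda>i j. (f i, f j) \<in> A)"
proof -
  define L where "L = {xs. set xs = W \<and> distinct xs}"
  have "L \<subseteq> {xs. set xs \<subseteq> W \<and> length xs \<le> card W}"
    by (auto simp: L_def distinct_card)
  then have "finite L"
    using finite_lists_length_le[OF assms(1)] finite_subset by blast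
  moreover have "L \<noteq> {}"
    unfolding L_def using finite_distinct_list[OF assms(1)] by auto
  ultimately have "Max (forward_arcs A ` L) \<in> forward_arcs A ` L" by simp
  then obtain xs where xs: "xs \<in> L" and eq: "forward_arcs A xs = Max (forward_arcs A ` L)"
    by (auto simp: image_iff)
  have max: "forward_arcs A ys \<le> forward_arcs A xs" if "ys \<in> L" for ys
    unfolding eq using that \<open>finite L\<close> by simp
  have len: "length xs = m" and dist: "distinct xs" and set: "set xs = W"
    using xs assms(2) by (auto simp: L_def distinct_card)
  have bij: "bij_betw ((!) xs) {..<m} W"
    using bij_betw_nth[OF dist] len set by auto
  have "median_tournament m (\<lambda>i j. (xs ! i, xs ! j) \<in> A)"
  proof
    fix i j assume "i < m" "j < m" "i \<noteq> j"
    then show "(xs ! i, xs ! j) \<in> A \<or> (xs ! j, xs ! i) \<in> A"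
      using total len set dist by (metis nth_eq_iff_index_eq nth_mem)
  next
    fix i j assume i: "i < m"
    show "card {l \<in> {j<..i}. (xs ! l, xs ! j) \<in> A} \<le> card {l \<in> {j<..i}. (xs ! j, xs ! l) \<in> A}"
    proof (cases "j \<le> i")
      case True
      \<comment> \<open>\<open>Q\<close> fills the positions \<open>j + 1\<close> to
        \<open>i\<close>, so \<open>P @ Q @ x # R\<close> is the order with \<open>x\<close> moved
        to just behind position \<open>i\<close>.\<close>
      define P x Q R where "P = take j xs" and "x = xs ! j"
        and "Q = drop (Suc j) (take (Suc i) xs)" and "R = drop (Suc i) xs"
      have "xs = take (Suc i) xs @ R" by (simp add: R_def)
      also have "take (Suc i) xs = take j (take (Suc i) xs) @ take (Suc i) xs ! j # Q"
        unfolding Q_def using i True len by (intro id_take_nth_drop) auto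
      also have "\<dots> = P @ x # Q"
        using True by (simp add: P_def x_def min_def)
      finally have xs_eq: "xs = P @ x # Q @ R" by simp
      then have "P @ Q @ x # R \<in> L"
        using dist set by (auto simp: L_def)
      from max[OF this] have
        "length (filter (\<lambda>y. (y, x) \<in> A) Q) \<le> length (filter (\<lambda>y. (x, y) \<in> A) Q)"
        using forward_arcs_move[of A P x Q R] xs_eq by simp
      moreover have "length (filter p Q) = card {l \<in> {j<..i}. p (xs ! l)}" for p
      proof -
        have "length Q = i - j" "\<And>l. l < i - j \<Longrightarrow> Q ! l = xs ! (Suc j + l)"
          using i len True by (auto simp: Q_def)
        then have "length (filter p Q) = card {l. l < i - j \<and> p (xs ! (Suc j + l))}"
          unfolding length_filter_conv_card by (intro arg_cong[where f = card]) auto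
        also have "\<dots> = card ((\<lambda>l. Suc j + l) ` {l. l < i - j \<and> p (xs ! (Suc j + l))})"
          by (intro card_image[symmetric]) (simp add: inj_on_def)
        also have "(\<lambda>l. Suc j + l) ` {l. l < i - j \<and> p (xs ! (Suc j + l))}
            = {l \<in> {j<..i}. p (xs ! l)}"
        proof (intro equalityI subsetI)
          fix l assume "l \<in> {l \<in> {j<..i}. p (xs ! l)}"
          then show "l \<in> (\<lambda>l. Suc j + l) ` {l. l < i - j \<and> p (xs ! (Suc j + l))}"
            by (intro image_eqI[of _ _ "l - Suc j"]) auto
        qed auto
        finally show ?thesis .
      qed
      ultimately show ?thesis unfolding x_def by auto
    qed auto
  qed
  with bij that show ?thesis by blast
qed

section \<open>Greedy embedding of a rooted tree\<close>

locale rooted_tree =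
  fixes V :: "'a set" and r :: 'a and E :: "'a rel"
  assumes finite_V: "finite V" and root: "r \<in> V" and arcs: "E \<subseteq> V \<times> V"
    and root_no_parent: "(u, r) \<notin> E"
    and parent_unique: "(u, v) \<in> E \<Longrightarrow> (u', v) \<in> E \<Longrightarrow> u = u'"
    and reach: "V \<subseteq> E\<^sup>* `` {r}"
begin

text \<open>Sinks are counted instead of leaves because the root can be a leaf although it has a
  child.\<close>

definition sinks :: "'a set" where
  "sinks = {x \<in> V. \<forall>c. (x, c) \<notin> E}"

lemma closed_imp_all:
  assumes "r \<in> S" "\<And>x c. x \<in> S \<Longrightarrow> (x, c) \<in> E \<Longrightarrow> c \<in> S"
  shows "V \<subseteq> S"
proof
  fix v assume "v \<in> V"
  then have "(r, v) \<in> E\<^sup>*" using reach by auto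
  then show "v \<in> S" by induction (use assms in auto)
qed

lemma parent_exists:
  assumes "v \<in> V" "v \<noteq> r"
  obtains u where "(u, v) \<in> E"
  using assms reach by (metis Image_singleton_iff rtranclE subsetD)

text \<open>
  Every node of \<open>B\<close> that is not a sink has a child in \<open>B\<close>, and distinct nodes have distinct
  children, so there are at most as many nodes with children as nodes with a parent in \<open>B\<close>.
\<close>
lemma card_tops_le_card_sinks:
  assumes "B \<subseteq> V" and closed: "\<And>x c. x \<in> B \<Longrightarrow> (x, c) \<in> E \<Longrightarrow> c \<in> B"
  shows "card {y \<in> B. \<forall>x \<in> B. (x, y) \<notin> E} \<le> card (B \<inter> sinks)"
proof -
  have fin: "finite B" using assms(1) finite_V by (rule finite_subset)
  define f where "f x = (SOME c. (x, c) \<in> E)" for x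
  have f: "(x, f x) \<in> E" if "x \<in> B - sinks" for x
    using that assms(1) unfolding f_def sinks_def by (auto intro: someI)
  have "card (B - sinks) \<le> card {y \<in> B. \<exists>x \<in> B. (x, y) \<in> E}"
  proof (rule card_inj_on_le[of f])
    show "inj_on f (B - sinks)"
      by (rule inj_onI) (metis f parent_unique)
    show "f ` (B - sinks) \<subseteq> {y \<in> B. \<exists>x \<in> B. (x, y) \<in> E}"
      using f closed by blast
  qed (use fin in auto)
  moreover have "card B = card {y \<in> B. \<exists>x \<in> B. (x, y) \<in> E} + card {y \<in> B. \<forall>x \<in> B. (x, y) \<notin> E}"
    using fin by (subst card_Un_disjoint[symmetric]) (auto intro: arg_cong[where f = card])
  moreover have "card B = card (B - sinks) + card (B \<inter> sinks)"
    using fin by (metis add.commute card_Int_Diff)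
  ultimately show ?thesis by linarith
qed

end

section \<open>Greedy placement and its invariant\<close>

locale tree_in_tournament = rooted_tree V r E + median_tournament m T
  for V :: "'a set" and r E m T +
  assumes m_pos: "0 < m"
begin

text \<open>
  Out-neighbours of \<open>x\<close> that precede its child \<open>c\<close> (or all of them if \<open>c\<close> is not embedded) were taken
  by children of nodes up to \<open>x\<close>.
\<close>
definition greedy_at :: "'a set \<Rightarrow> ('a \<Rightarrow> nat) \<Rightarrow> 'a \<Rightarrow> 'a \<Rightarrow> bool" where
  "greedy_at S \<phi> x c \<longleftrightarrow> (\<forall>l<m. \<phi> x < l \<longrightarrow> T (\<phi> x) l \<longrightarrow> (c \<in> S \<longrightarrow> l < \<phi> c) \<longrightarrow>
     (\<exists>y z. (y, z) \<in> E \<and> z \<in> S \<and> \<phi> z = l \<and> \<phi> y \<le> \<phi> x))"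

text \<open>Nodes at positions below \<open>t\<close> are finished, the node at \<open>t\<close> may
  have received only some of its children, and later nodes have received none.\<close>

definition greedy_state :: "nat \<Rightarrow> 'a set \<Rightarrow> ('a \<Rightarrow> nat) \<Rightarrow> bool" where
  "greedy_state t S \<phi> \<longleftrightarrow> r \<in> S \<and> S \<subseteq> V \<and> \<phi> r = 0 \<and> inj_on \<phi> S \<and> \<phi> ` S \<subseteq> {..<m} \<and>
     (\<forall>(x, c) \<in> E. c \<in> S \<longrightarrow> x \<in> S \<and> \<phi> x < \<phi> c \<and> T (\<phi> x) (\<phi> c) \<and> \<phi> x \<le> t) \<and>
     (\<forall>(x, c) \<in> E. x \<in> S \<and> (\<phi> x < t \<or> c \<in> S) \<longrightarrow> greedy_at S \<phi> x c)"

lemma greedy_stateD: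
  assumes "greedy_state t S \<phi>"
  shows "r \<in> S" "S \<subseteq> V" "\<phi> r = 0" "inj_on \<phi> S" "\<phi> ` S \<subseteq> {..<m}"
    "(x, c) \<in> E \<Longrightarrow> c \<in> S \<Longrightarrow> x \<in> S"
    "(x, c) \<in> E \<Longrightarrow> c \<in> S \<Longrightarrow> \<phi> x < \<phi> c"
    "(x, c) \<in> E \<Longrightarrow> c \<in> S \<Longrightarrow> T (\<phi> x) (\<phi> c)"
    "(x, c) \<in> E \<Longrightarrow> c \<in> S \<Longrightarrow> \<phi> x \<le> t"
    "(x, c) \<in> E \<Longrightarrow> x \<in> S \<Longrightarrow> \<phi> x < t \<or> c \<in> S \<Longrightarrow> greedy_at S \<phi> x c"
  using assms unfolding greedy_state_def by blast+

lemma greedy_state_0: "greedy_state 0 {r} (\<lambda>_. 0)"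
  using root m_pos root_no_parent unfolding greedy_state_def by auto

text \<open>Position 0 holds the root, so every other occupied position holds a node with a parent.
  This turns occupancy into the witnesses that \<open>greedy_at\<close> asks for.\<close>

lemma greedy_state_hit:
  assumes "greedy_state t S \<phi>" "l \<in> \<phi> ` S" "0 < l"
  obtains y z where "(y, z) \<in> E" "z \<in> S" "\<phi> z = l" "\<phi> y \<le> t"
proof -
  from assms(2) obtain z where z: "z \<in> S" "\<phi> z = l" by auto
  with assms(3) greedy_stateD[OF assms(1)] have "z \<in> V" "z \<noteq> r" by auto
  then obtain y where "(y, z) \<in> E" by (rule parent_exists)
  with z that greedy_stateD(9)[OF assms(1)] show ?thesis by blast
qed

text \<open>\<open>greedy_at\<close> only asks for positions to be taken, so it survives for the
  other children; for \<open>c\<close> it holds because \<open>l\<close> is the least free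
  out-neighbour after \<open>t\<close>.\<close>

lemma greedy_state_extend:
  assumes st: "greedy_state t S \<phi>"
    and xc: "(x, c) \<in> E" "x \<in> S" "c \<notin> S" "\<phi> x = t"
    and l: "l < m" "t < l" "T t l" "l \<notin> \<phi> ` S"
    and least: "\<And>l'. l' < l \<Longrightarrow> t < l' \<Longrightarrow> T t l' \<Longrightarrow> l' \<in> \<phi> ` S"
  shows "greedy_state t (insert c S) (\<phi>(c := l))"
proof -
  note D = greedy_stateD[OF st]
  let ?S = "insert c S" and ?\<phi> = "\<phi>(c := l)"
  have par_c: "u = x" if "(u, c) \<in> E" for u using that xc(1) parent_unique by blast
  have "c \<noteq> r" "c \<noteq> x" using xc D(1) by auto
  have A: "u \<in> ?S \<and> ?\<phi> u < ?\<phi> w \<and> T (?\<phi> u) (?\<phi> w) \<and> ?\<phi> u \<le> t"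
    if "(u, w) \<in> E" "w \<in> ?S" for u w
  proof (cases "w = c")
    case True
    with par_c that xc l \<open>c \<noteq> x\<close> show ?thesis by auto
  next
    case False
    with that have "w \<in> S" by simp
    with that D(6) xc(3) have "u \<noteq> c" by blast
    with False \<open>w \<in> S\<close> that D(6-9)[of u w] show ?thesis by simp
  qed
  have old: "\<exists>y z. (y, z) \<in> E \<and> z \<in> ?S \<and> ?\<phi> z = l' \<and> ?\<phi> y \<le> k"
    if "(y, z) \<in> E" "z \<in> S" "\<phi> z = l'" "\<phi> y \<le> k" for y z l' k
  proof (intro exI conjI)
    have "y \<noteq> c" "z \<noteq> c" using that(1,2) D(6) xc(3) by auto
    then show "?\<phi> z = l'" "?\<phi> y \<le> k" using that by auto
  qed (use that in auto)
  have B: "greedy_at ?S ?\<phi> u w"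
    if uw: "(u, w) \<in> E" "u \<in> ?S" "?\<phi> u < t \<or> w \<in> ?S" for u w
  proof -
    \<comment> \<open>The new node imposes no requirement: it lies after \<open>t\<close>, and none
      of its children is in \<open>S\<close>, as \<open>S\<close> is closed under parents.\<close>
    have "u \<noteq> c"
    proof
      assume "u = c"
      with uw l have "w \<in> ?S" by auto
      with uw \<open>u = c\<close> D(6) xc(3) have "w = c" by blast
      with uw \<open>u = c\<close> par_c \<open>c \<noteq> x\<close> show False by blast
    qed
    with uw have "u \<in> S" by simp
    show ?thesis
    proof (cases "w = c")
      case True
      with uw par_c have "u = x" by blast
      show ?thesis unfolding greedy_at_def
      proof (intro allI impI)
        fix l' assume l': "l' < m" "?\<phi> u < l'" "T (?\<phi> u) l'" "w \<in> ?S \<longrightarrow> l' < ?\<phi> w"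
        with True \<open>u = x\<close> \<open>c \<noteq> x\<close> xc(4) have "l' \<in> \<phi> ` S" "0 < l'" by (auto intro: least)
        with st obtain y z where "(y, z) \<in> E" "z \<in> S" "\<phi> z = l'" "\<phi> y \<le> t"
          by (rule greedy_state_hit)
        then show "\<exists>y z. (y, z) \<in> E \<and> z \<in> ?S \<and> ?\<phi> z = l' \<and> ?\<phi> y \<le> ?\<phi> u"
          using old \<open>u = x\<close> \<open>c \<noteq> x\<close> xc(4) by (metis fun_upd_other)
      qed
    next
      case False
      with uw \<open>u \<noteq> c\<close> \<open>u \<in> S\<close> have "greedy_at S \<phi> u w" using D(10) by auto
      then show ?thesis
        unfolding greedy_at_def using False \<open>u \<noteq> c\<close> old
        by (metis fun_upd_other insert_iff)
    qed
  qed
  have "c \<in> V" using xc(1) arcs by auto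
  moreover have "inj_on ?\<phi> ?S"
    using D(4) l(4) xc(3) by (auto simp: inj_on_def)
  moreover have "?\<phi> ` ?S \<subseteq> {..<m}" "?\<phi> r = 0" "r \<in> ?S"
    using D(1,3,5) l(1) \<open>c \<noteq> r\<close> by auto
  ultimately show ?thesis
    unfolding greedy_state_def using D(2) A B by blast
qed

text \<open>A state for \<open>t\<close> with the most embedded nodes cannot be extended, so the
  node at \<open>t\<close> is finished and the same state serves for \<open>Suc t\<close>.
  Maximality replaces a loop over the children.\<close>

lemma greedy_state_exists: "\<exists>S \<phi>. greedy_state t S \<phi>"
proof (induction t)
  case 0
  show ?case using greedy_state_0 by blast
next
  case (Suc t)
  let ?P = "\<lambda>n. \<exists>S \<phi>. greedy_state t S \<phi> \<and> card S = n"
  have "\<exists>n. ?P n" using Suc by blast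
  moreover have "n \<le> card V" if "?P n" for n
    using that greedy_stateD(2) finite_V card_mono by metis
  ultimately have "?P (Greatest ?P)" and max: "\<And>n. ?P n \<Longrightarrow> n \<le> Greatest ?P"
    using GreatestI_ex_nat[of ?P "card V"] Greatest_le_nat[of ?P _ "card V"] by blast+
  then obtain S \<phi> where st: "greedy_state t S \<phi>" and card: "card S = Greatest ?P" by blast
  note D = greedy_stateD[OF st]
  have fin: "finite S" using D(2) finite_V finite_subset by blast
  have hit: "l \<in> \<phi> ` S"
    if xc: "(x, c) \<in> E" "x \<in> S" "c \<notin> S" "\<phi> x = t" and l: "l < m" "t < l" "T t l" for x c l
  proof (rule ccontr)
    assume "l \<notin> \<phi> ` S"
    let ?Q = "\<lambda>l. l < m \<and> t < l \<and> T t l \<and> l \<notin> \<phi> ` S"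
    have Q: "?Q (Least ?Q)" by (rule LeastI[of ?Q l]) (use l \<open>l \<notin> \<phi> ` S\<close> in blast)
    have "greedy_state t (insert c S) (\<phi>(c := Least ?Q))"
    proof (rule greedy_state_extend[OF st xc])
      fix l' assume "l' < Least ?Q" "t < l'" "T t l'"
      then show "l' \<in> \<phi> ` S" using not_less_Least[of l' ?Q] Q by linarith
    qed (use Q in blast)+
    then have "card (insert c S) \<le> card S" unfolding card by (intro max) blast
    with fin xc(3) show False by simp
  qed
  have "greedy_at S \<phi> x c" if "(x, c) \<in> E" "x \<in> S" "\<phi> x < Suc t \<or> c \<in> S" for x c
  proof (cases "\<phi> x < t \<or> c \<in> S")
    case True
    with that D(10) show ?thesis by blast
  next
    case False
    with that have "\<phi> x = t" "c \<notin> S" by auto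
    show ?thesis unfolding greedy_at_def
    proof (intro allI impI)
      fix l assume l: "l < m" "\<phi> x < l" "T (\<phi> x) l"
      with hit that \<open>\<phi> x = t\<close> \<open>c \<notin> S\<close> have "l \<in> \<phi> ` S" "0 < l" by auto
      with st show "\<exists>y z. (y, z) \<in> E \<and> z \<in> S \<and> \<phi> z = l \<and> \<phi> y \<le> \<phi> x"
        unfolding \<open>\<phi> x = t\<close> by (metis greedy_state_hit)
    qed
  qed
  then have "greedy_state (Suc t) S \<phi>"
    using st unfolding greedy_state_def by fastforce
  then show ?case by blast
qed

section \<open>Counting free positions against embedded sinks\<close>

lemma card_free_le_card_sinks:
  assumes st: "greedy_state m S \<phi>" and "S \<noteq> V"
  shows "n \<le> m \<Longrightarrow> card {l. l < n \<and> l \<notin> \<phi> ` S} \<le> card {x \<in> S \<inter> sinks. \<phi> x < n}"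
\<comment> \<open>If the last position \<open>i\<close> is free, the order is cut behind
  \<open>j\<close>: induction covers the positions up to \<open>j\<close>, the median property those
  from \<open>j + 1\<close> to \<open>i\<close>.\<close>
proof (induction n rule: less_induct)
  case (less n)
  note D = greedy_stateD[OF st]
  have fin: "finite S" using D(2) finite_V finite_subset by blast
  show ?case
  proof (cases n)
    case 0
    then show ?thesis by simp
  next
    case (Suc i)
    show ?thesis
    proof (cases "i \<in> \<phi> ` S")
      case True
      then have "{l. l < n \<and> l \<notin> \<phi> ` S} = {l. l < i \<and> l \<notin> \<phi> ` S}"
        using Suc by (auto simp: less_Suc_eq)
      also have "card \<dots> \<le> card {x \<in> S \<inter> sinks. \<phi> x < i}"
        using less Suc by simp
      also have "\<dots> \<le> card {x \<in> S \<inter> sinks. \<phi> x < n}"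
        using fin Suc by (intro card_mono) auto
      finally show ?thesis .
    next
      case False
      then have "i \<noteq> 0" using D(1,3) by force
      define active where
        "active x \<longleftrightarrow> x \<in> S \<and> \<phi> x < i \<and> (\<exists>c. (x, c) \<in> E \<and> (c \<in> S \<longrightarrow> i < \<phi> c))" for x
      \<comment> \<open>Otherwise the nodes before \<open>i\<close> contain the root and are closed
        under children, hence exhaust \<open>V\<close>, against \<open>S \<noteq> V\<close>.\<close>
      have "\<exists>x. active x"
      proof (rule ccontr)
        assume *: "\<nexists>x. active x"
        have "V \<subseteq> {x \<in> S. \<phi> x < i}"
        proof (rule closed_imp_all)
          show "r \<in> {x \<in> S. \<phi> x < i}" using D(1,3) \<open>i \<noteq> 0\<close> by simp
          fix x c assume "x \<in> {x \<in> S. \<phi> x < i}" "(x, c) \<in> E"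
          with * have "\<not> (c \<in> S \<longrightarrow> i < \<phi> c)" unfolding active_def by blast
          then have "c \<in> S" "\<phi> c \<le> i" by auto
          with False show "c \<in> {x \<in> S. \<phi> x < i}" by (auto simp: le_less)
        qed
        with D(2) \<open>S \<noteq> V\<close> show False by auto
      qed
      then obtain a where a: "active a" and a_max: "\<And>x. active x \<Longrightarrow> \<phi> x \<le> \<phi> a"
        using ex_has_greatest_nat[of active _ \<phi> i] unfolding active_def
        by (metis less_or_eq_imp_le)
      define j where "j = \<phi> a"
      from a obtain c where c: "(a, c) \<in> E" "c \<in> S \<longrightarrow> i < \<phi> c" and aS: "a \<in> S" and "j < i"
        unfolding active_def j_def by auto
      have im: "i < m" using Suc less by simp
      define B where "B = {y \<in> S. j < \<phi> y \<and> \<phi> y \<le> i}"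
      \<comment> \<open>In a state for \<open>m\<close> all nodes are finished. As \<open>c\<close>
        is not embedded up to \<open>i\<close>, greediness says that all out-neighbours of
        \<open>j\<close> in the interval are taken.\<close>
      have "greedy_at S \<phi> a c"
        using D(10) c aS \<open>j < i\<close> im unfolding j_def by simp
      then have taken: "\<exists>y z. (y, z) \<in> E \<and> z \<in> S \<and> \<phi> z = l \<and> \<phi> y \<le> j"
        if "l \<in> {j<..i}" "T j l" for l
        using that c(2) im unfolding greedy_at_def j_def by auto
      have "{l. j < l \<and> l \<le> i \<and> l \<notin> \<phi> ` S} \<subseteq> {l \<in> {j<..i}. T l j}"
      proof
        fix l assume l: "l \<in> {l. j < l \<and> l \<le> i \<and> l \<notin> \<phi> ` S}"
        then have "\<not> T j l" using taken[of l] by auto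
        with l im \<open>j < i\<close> total[of j l] show "l \<in> {l \<in> {j<..i}. T l j}" by auto
      qed
      then have "card {l. j < l \<and> l \<le> i \<and> l \<notin> \<phi> ` S} \<le> card {l \<in> {j<..i}. T l j}"
        by (rule card_mono[rotated]) simp
      also have "\<dots> \<le> card {l \<in> {j<..i}. T j l}"
        using im by (rule median)
      \<comment> \<open>These positions are held by nodes whose parents lie at or before
        \<open>j\<close>, hence outside \<open>B\<close>.\<close>
      also have "\<dots> \<le> card {y \<in> B. \<forall>x \<in> B. (x, y) \<notin> E}"
      proof (rule surj_card_le[where f = \<phi>])
        show "finite {y \<in> B. \<forall>x \<in> B. (x, y) \<notin> E}" using fin by (simp add: B_def)
        show "{l \<in> {j<..i}. T j l} \<subseteq> \<phi> ` {y \<in> B. \<forall>x \<in> B. (x, y) \<notin> E}"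
        proof
          fix l assume l: "l \<in> {l \<in> {j<..i}. T j l}"
          then obtain y z where yz: "(y, z) \<in> E" "z \<in> S" "\<phi> z = l" "\<phi> y \<le> j"
            using taken by blast
          have "(x, z) \<notin> E" if "x \<in> B" for x
            using that yz(1,4) parent_unique[of x z y] by (auto simp: B_def)
          with yz l show "l \<in> \<phi> ` {y \<in> B. \<forall>x \<in> B. (x, y) \<notin> E}"
            by (auto simp: B_def)
        qed
      qed
      \<comment> \<open>\<open>B\<close> is closed under children: by the choice of
        \<open>a\<close>, no node placed after \<open>a\<close> and before \<open>i\<close> is
        active.\<close>
      also have "\<dots> \<le> card (B \<inter> sinks)"
      proof (rule card_tops_le_card_sinks)
        show "B \<subseteq> V" using D(2) by (auto simp: B_def)
        fix x d assume x: "x \<in> B" and xd: "(x, d) \<in> E"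
        have "\<phi> x \<noteq> i" using x False by (auto simp: B_def)
        with x a_max[of x] xd have "d \<in> S" "\<phi> d \<le> i"
          unfolding B_def active_def j_def by force+
        with x xd D(7)[of x d] show "d \<in> B" by (auto simp: B_def)
      qed
      finally have *: "card {l. j < l \<and> l \<le> i \<and> l \<notin> \<phi> ` S} \<le> card (B \<inter> sinks)" .
      have **: "card {l. l < Suc j \<and> l \<notin> \<phi> ` S} \<le> card {x \<in> S \<inter> sinks. \<phi> x < Suc j}"
        using less \<open>j < i\<close> Suc by simp
      have "{l. l < n \<and> l \<notin> \<phi> ` S}
          = {l. l < Suc j \<and> l \<notin> \<phi> ` S} \<union> {l. j < l \<and> l \<le> i \<and> l \<notin> \<phi> ` S}"
        using Suc \<open>j < i\<close> by auto
      then have "card {l. l < n \<and> l \<notin> \<phi> ` S}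
          \<le> card {l. l < Suc j \<and> l \<notin> \<phi> ` S} + card {l. j < l \<and> l \<le> i \<and> l \<notin> \<phi> ` S}"
        by (simp only: card_Un_le)
      also have "\<dots> \<le> card {x \<in> S \<inter> sinks. \<phi> x < Suc j} + card (B \<inter> sinks)"
        using * ** by simp
      also have "\<dots> = card ({x \<in> S \<inter> sinks. \<phi> x < Suc j} \<union> (B \<inter> sinks))"
        using fin by (intro card_Un_disjoint[symmetric]) (auto simp: B_def)
      also have "\<dots> \<le> card {x \<in> S \<inter> sinks. \<phi> x < n}"
        using fin Suc \<open>j < i\<close> by (intro card_mono) (auto simp: B_def)
      finally show ?thesis .
    qed
  qed
qed

text \<open>If \<open>S\<close> misses a node, then \<open>V - S\<close> is closed under children
  and contains a sink. So fewer than \<open>card sinks\<close> positions are free and fewer than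
  \<open>card V\<close> are occupied, which makes \<open>m\<close> too small.\<close>

lemma embedding_exists:
  assumes "card V + card sinks \<le> m + 1"
  shows "\<exists>\<phi>. inj_on \<phi> V \<and> \<phi> ` V \<subseteq> {..<m} \<and> (\<forall>(x, c) \<in> E. T (\<phi> x) (\<phi> c))"
proof -
  obtain S \<phi> where st: "greedy_state m S \<phi>" using greedy_state_exists by blast
  note D = greedy_stateD[OF st]
  have fin: "finite S" using D(2) finite_V finite_subset by blast
  have fin_sinks: "finite sinks" using finite_V by (simp add: sinks_def)
  have "S = V"
  proof (rule ccontr)
    assume "S \<noteq> V"
    with D(2) have "\<exists>v \<in> V - S. True" by blast
    \<comment> \<open>Some arc leaves \<open>S\<close>; its head has its only parent in
      \<open>S\<close>, hence none in \<open>V - S\<close>.\<close>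
    with D(1) closed_imp_all[of S] obtain x c where xc: "x \<in> S" "(x, c) \<in> E" "c \<notin> S" by blast
    with arcs have "c \<in> V - S" by auto
    moreover have "(u, c) \<notin> E" if "u \<in> V - S" for u
      using that xc parent_unique[of u c x] by blast
    ultimately have "{y \<in> V - S. \<forall>x \<in> V - S. (x, y) \<notin> E} \<noteq> {}" by blast
    then have "0 < card {y \<in> V - S. \<forall>x \<in> V - S. (x, y) \<notin> E}"
      using finite_V by (simp add: card_gt_0_iff)
    also have "\<dots> \<le> card ((V - S) \<inter> sinks)"
      by (rule card_tops_le_card_sinks) (use arcs D(6) in blast)+
    finally have "card (S \<inter> sinks) < card sinks"
      using fin_sinks by (intro psubset_card_mono) (auto simp: card_gt_0_iff)
    moreover have "card S < card V"
      using D(2) \<open>S \<noteq> V\<close> finite_V by (intro psubset_card_mono) auto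
    moreover have "card {l. l < m \<and> l \<notin> \<phi> ` S} \<le> card {x \<in> S \<inter> sinks. \<phi> x < m}"
      using card_free_le_card_sinks[OF st \<open>S \<noteq> V\<close>, of m] by simp
    moreover have "\<dots> \<le> card (S \<inter> sinks)"
      using fin by (intro card_mono) auto
    moreover have "{l. l < m \<and> l \<notin> \<phi> ` S} = {..<m} - \<phi> ` S" by auto
    then have "card {l. l < m \<and> l \<notin> \<phi> ` S} = m - card S"
      using D(4,5) fin by (simp add: card_Diff_subset card_image)
    ultimately show False using assms by linarith
  qed
  with D arcs show ?thesis by (intro exI[of _ \<phi>]) auto
qed

end

theorem (in rooted_tree) embeds_in_tournament:
  assumes "finite W" "card V + card sinks \<le> card W + 1"
    and "\<And>x y. x \<in> W \<Longrightarrow> y \<in> W \<Longrightarrow> x \<noteq> y \<Longrightarrow> (x, y) \<in> A \<or> (y, x) \<in> A"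
  shows "\<exists>f. inj_on f V \<and> f ` V \<subseteq> W \<and> (\<forall>(x, c) \<in> E. (f x, f c) \<in> A)"
proof -
  obtain g where g: "bij_betw g {..<card W} W"
    and med: "median_tournament (card W) (\<lambda>i j. (g i, g j) \<in> A)"
    using obtain_median_order[OF assms(1) refl assms(3)] by blast
  have "0 < card V" using root finite_V by (auto simp: card_gt_0_iff)
  \<comment> \<open>The root has no parent in \<open>V\<close>, so a sink exists. Then
    \<open>card V + card sinks\<close> is at least 2, and position 0 is available for the
    root.\<close>
  have "{y \<in> V. \<forall>x \<in> V. (x, y) \<notin> E} \<noteq> {}"
    using root root_no_parent by blast
  then have "0 < card {y \<in> V. \<forall>x \<in> V. (x, y) \<notin> E}"
    using finite_V by (simp add: card_gt_0_iff)
  then have "0 < card (V \<inter> sinks)"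
    using card_tops_le_card_sinks[of V] arcs by force
  moreover have "V \<inter> sinks = sinks"
    by (auto simp: sinks_def)
  ultimately have "0 < card sinks" by simp
  with \<open>0 < card V\<close> have "0 < card W" using assms(2) by linarith
  interpret tree_in_tournament V r E "card W" "\<lambda>i j. (g i, g j) \<in> A"
    using rooted_tree_axioms med \<open>0 < card W\<close>
    by (simp add: tree_in_tournament_def tree_in_tournament_axioms_def)
  obtain \<phi> where \<phi>: "inj_on \<phi> V" "\<phi> ` V \<subseteq> {..<card W}" "\<forall>(x, c) \<in> E. (g (\<phi> x), g (\<phi> c)) \<in> A"
    using embedding_exists[OF assms(2)] by blast
  have "inj_on (g \<circ> \<phi>) V"
    using \<phi>(1,2) g by (meson bij_betw_def comp_inj_on inj_on_subset)
  moreover have "(g \<circ> \<phi>) ` V \<subseteq> W"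
    using \<phi>(2) g by (auto simp: bij_betw_def)
  ultimately show ?thesis using \<phi>(3) by (intro exI[of _ "g \<circ> \<phi>"]) auto
qed

section \<open>Arborescences as rooted trees\<close>

text \<open>A path visits its end only once, so the piece before an arc into \<open>v\<close> avoids
  \<open>v\<close>.\<close>

lemma (in pair_graph) apath_last_arc:
  assumes "apath r p v" "(u, v) \<in> set p"
  obtains q where "apath r q u" "v \<notin> set (awalk_verts r q)" "(u, v) \<in> parcs G"
proof -
  obtain q s where p: "p = q @ (u, v) # s" using assms(2) by (meson split_list)
  with assms(1) have q: "apath r q u" and s: "apath u ((u, v) # s) v"
    and disj: "set (awalk_verts r q) \<inter> set (tl (awalk_verts u ((u, v) # s))) = {}"
    by (auto simp: apath_append_iff apath_Cons_iff)
  from s have "(u, v) \<in> parcs G" by (simp add: apath_Cons_iff)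
  moreover have "v \<notin> set (awalk_verts r q)"
    using disj s by (auto simp: apath_Cons_iff dest: hd_in_awalk_verts)
  ultimately show ?thesis using q that by blast
qed

text \<open>Going back to \<open>r\<close> along one path and out along the other joins
  \<open>u1\<close> to \<open>u2\<close> without meeting \<open>v\<close>; the two arcs at
  \<open>v\<close> close the cycle.\<close>

lemma (in pair_graph) two_apaths_imp_cycle:
  assumes "apath r p1 v" "(u1, v) \<in> set p1" "apath r p2 v" "(u2, v) \<in> set p2" "u1 \<noteq> u2"
  shows "\<exists>p. cycle p \<and> length p \<ge> 3"
proof -
  obtain q1 where q1: "apath r q1 u1" "v \<notin> set (awalk_verts r q1)" and u1: "(u1, v) \<in> parcs G"
    using apath_last_arc[OF assms(1,2)] .
  obtain q2 where q2: "apath r q2 u2" "v \<notin> set (awalk_verts r q2)" and u2: "(u2, v) \<in> parcs G"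
    using apath_last_arc[OF assms(3,4)] .
  let ?w = "rev_path q1 @ q2"
  have w1: "awalk u1 (rev_path q1) r" and w2: "awalk r q2 u2"
    using q1 q2 by (auto intro: awalkI_apath)
  then have w: "awalk u1 ?w u2" by auto
  have "set (awalk_verts u1 ?w) = set (awalk_verts u1 (rev_path q1)) \<union> set (awalk_verts r q2)"
    using w1 w2 by (simp add: set_awalk_verts_append)
  also have "set (awalk_verts u1 (rev_path q1)) = set (awalk_verts r q1)"
    using q1(1) by (subst awalk_verts_rev_path) (auto intro: awalkI_apath)
  finally have v_w: "v \<notin> set (awalk_verts u1 ?w)" using q1 q2 by blast
  \<comment> \<open>The walk may repeat vertices. Shortening it to a path adds no vertices, so
    \<open>v\<close> is still avoided.\<close>
  define a where "a = awalk_to_apath ?w"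
  have a: "apath u1 a u2" unfolding a_def using w by (rule apath_awalk_to_apath)
  then have aw: "awalk u1 a u2" by (rule awalkI_apath)
  have "set a \<subseteq> set ?w" unfolding a_def using w by (rule awalk_to_apath_subset)
  then have "set (awalk_verts u1 a) \<subseteq> set (awalk_verts u1 ?w)"
    unfolding set_awalk_verts[OF w] set_awalk_verts[OF aw] by (intro Un_mono image_mono) auto
  with v_w have v_a: "v \<notin> set (awalk_verts u1 a)" by blast
  \<comment> \<open>Since \<open>u1 \<noteq> u2\<close>, the cycle has an arc besides the two at
    \<open>v\<close>, hence length at least 3.\<close>
  have "a \<noteq> []" using aw assms(5) by (auto simp: awalk_Nil_iff)
  let ?p = "(v, u1) # a @ [(u2, v)]"
  have tail: "awalk u1 (a @ [(u2, v)]) v"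
    using aw u2 by (auto simp: awalk_simps wellformed')
  then have "awalk v ?p v" using arcs_symmetric[OF u1]
    by (simp add: awalk_Cons_iff del: awalk_append_iff)
  moreover have "awalk_verts u1 (a @ [(u2, v)]) = awalk_verts u1 a @ [v]"
    using tail aw by (subst awalk_verts_append) auto
  then have "distinct (tl (awalk_verts v ?p))"
    using a v_a by (simp add: apath_def)
  ultimately have "cycle ?p" unfolding cycle_def by blast
  moreover have "length ?p \<ge> 3" using \<open>a \<noteq> []\<close> by (cases a) auto
  ultimately show ?thesis by blast
qed

text \<open>A second parent would create a cycle, and an arc into \<open>r\<close> a nonempty path
  from \<open>r\<close> to itself. \<open>E\<close> is kept general so that it can be
  \<open>parcs D\<close> or its converse.\<close>

lemma rooted_tree_if_oriented_away:
  fixes G :: "'a pair_pre_digraph"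
  assumes tree: "undirected_tree G" and r: "r \<in> pverts G" and E: "parcs G = E \<union> E\<inverse>"
    and away: "\<And>u v. (u, v) \<in> E \<Longrightarrow> \<exists>p. pre_digraph.apath (with_proj G) r p v \<and> (u, v) \<in> set p"
  shows "rooted_tree (pverts G) r E"
proof -
  interpret pair_graph G using tree by (simp add: undirected_tree_def)
  have root: "(u, r) \<notin> E" for u
  proof
    assume "(u, r) \<in> E"
    then obtain p where p: "apath r p r" "(u, r) \<in> set p" using away by blast
    then show False using apath_nonempty_ends[of r p r] by force
  qed
  have unique: "u = u'" if "(u, v) \<in> E" "(u', v) \<in> E" for u u' v
    using away[OF that(1)] away[OF that(2)] two_apaths_imp_cycle tree
    unfolding undirected_tree_def by blast
  have "v \<in> E\<^sup>* `` {r}" if "v \<in> pverts G" for v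
  proof -
    have "connected G" using tree by (simp add: undirected_tree_def)
    then have "r \<rightarrow>\<^sup>*\<^bsub>mk_symmetric G\<^esub> v"
      unfolding connected_def strongly_connected_def using r that by auto
    then have "r \<rightarrow>\<^sup>*\<^bsub>G\<^esub> v" using sym_arcs by (simp add: reachable_mk_symmetric_eq)
    then have "(r, v) \<in> (E \<union> E\<inverse>)\<^sup>*"
      unfolding reachable_def using E by (auto dest: rtrancl_on_rtranclI)
    then have "(r, v) \<in> E\<^sup>*"
    proof induction
      case (step w w')
      show ?case
      proof (cases "(w, w') \<in> E")
        case True
        with step.IH show ?thesis by simp
      next
        \<comment> \<open>The edge is traversed against its arc. A directed walk from
          \<open>r\<close> to \<open>w\<close> must end with the unique arc into \<open>w\<close>,
          so it passes through \<open>w'\<close>.\<close>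
        case False
        with step.hyps have "(w', w) \<in> E" by auto
        with step.IH root unique show ?thesis by (metis rtranclE)
      qed
    qed simp
    then show ?thesis by simp
  qed
  moreover have "E \<subseteq> pverts G \<times> pverts G"
    using E wellformed' by auto
  ultimately show ?thesis
    using pair_finite_verts r root unique by unfold_locales blast+
qed

lemma parcs_mk_symmetric_with_proj:
  "parcs (mk_symmetric (with_proj D)) = parcs D \<union> (parcs D)\<inverse>"
  by (auto simp: parcs_mk_symmetric)

lemma arborescence_rooted_tree:
  assumes "arborescence D"
  obtains r where "rooted_tree (pverts D) r (parcs D) \<or> rooted_tree (pverts D) r ((parcs D)\<inverse>)"
proof -
  let ?G = "mk_symmetric (with_proj D)"
  have tree: "undirected_tree ?G"
    using assms
    by (auto simp: arborescence_def in_arborescence_def out_arborescence_def oriented_tree_def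
      orientation_def)
  then interpret pair_graph ?G by (simp add: undirected_tree_def)
  note arcs = parcs_mk_symmetric_with_proj[of D]
  from assms consider
      r where "r \<in> pverts D" "\<forall>e \<in> parcs D. oriented_away D r e"
    | r where "r \<in> pverts D" "\<forall>e \<in> parcs D. oriented_towards D r e"
    unfolding arborescence_def in_arborescence_def out_arborescence_def by blast
  then show ?thesis
  proof cases
    case 1
    have "rooted_tree (pverts ?G) r (parcs D)"
    proof (rule rooted_tree_if_oriented_away[OF tree])
      fix u v assume "(u, v) \<in> parcs D"
      with 1 have "oriented_away D r (u, v)" by blast
      then show "\<exists>p. apath r p v \<and> (u, v) \<in> set p" by (simp add: oriented_away_def)
    qed (use 1 arcs in auto)
    with that show ?thesis by auto
  next
    case 2
    have "rooted_tree (pverts ?G) r ((parcs D)\<inverse>)"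
    proof (rule rooted_tree_if_oriented_away[OF tree])
      fix u v assume "(u, v) \<in> (parcs D)\<inverse>"
      with 2 have "oriented_towards D r (v, u)" by blast
      then obtain p where p: "apath v p r" "(v, u) \<in> set p"
        by (auto simp: oriented_towards_def)
      \<comment> \<open>Reversing a path towards \<open>r\<close> gives a path from \<open>r\<close>
        that uses the reversed arc.\<close>
      have "(u, v) \<in> set (rev_path p)"
        using p(2) by (induction p) auto
      with p(1) show "\<exists>p. apath r p v \<and> (u, v) \<in> set p"
        by (metis apath_rev_path)
    qed (use 2 arcs in auto)
    with that show ?thesis by auto
  qed
qed

text \<open>The only possible neighbour of a sink is its parent.\<close>

lemma card_sinks_le_card_leaves:
  assumes "rooted_tree (pverts D) r E" and E: "E = parcs D \<or> E = (parcs D)\<inverse>"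
  shows "card (rooted_tree.sinks (pverts D) E) \<le> card (leaves D)"
proof -
  interpret rooted_tree "pverts D" r E by fact
  have "v \<in> leaves D" if "v \<in> sinks" for v
  proof -
    have "{u. (v, u) \<in> parcs (mk_symmetric (with_proj D))} = {u. (u, v) \<in> E}"
      using that E by (auto simp: sinks_def parcs_mk_symmetric_with_proj)
    moreover have "finite {u. (u, v) \<in> E}"
      by (rule finite_subset[OF _ finite_V]) (use arcs in auto)
    then have "card {u. (u, v) \<in> E} \<le> 1"
      using parent_unique by (auto simp: card_le_Suc0_iff_eq)
    ultimately show ?thesis using that by (simp add: leaves_def sinks_def)
  qed
  then show ?thesis using finite_V by (intro card_mono) (auto simp: leaves_def)
qed

section \<open>Translation to subdigraphs and tournaments\<close>

lemma contains_subdigraphI: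
  assumes "pair_wf_digraph T" "pair_wf_digraph D"
    and "inj_on f (pverts D)" "f ` pverts D \<subseteq> pverts T"
    and "\<And>u v. (u, v) \<in> parcs D \<Longrightarrow> (f u, f v) \<in> parcs T"
  shows "contains_subdigraph T D"
proof -
  interpret T: pair_wf_digraph T by fact
  interpret D: pair_wf_digraph D by fact
  \<comment> \<open>Arcs are pairs, so \<open>f\<close> determines the arc map; the image of
    \<open>D\<close> is the required subdigraph.\<close>
  let ?h = "\<lparr>iso_verts = f, iso_arcs = map_prod f f, iso_head = snd, iso_tail = fst\<rparr>"
  have iso: "pre_digraph.digraph_isomorphism (with_proj D) ?h"
    unfolding pre_digraph.digraph_isomorphism_def
    using assms(3) D.wellformed' D.wf_digraph_axioms
    by (auto simp: inj_on_def)
  have "wf_digraph (app_iso ?h (with_proj D))"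
    using iso by (rule D.wf_digraphI_app_iso)
  then have "subgraph (app_iso ?h (with_proj D)) (with_proj T)"
    unfolding subgraph_def compatible_def
    using assms(4,5) T.wf_digraph_axioms by auto
  with iso show ?thesis
    unfolding contains_subdigraph_def digraph_iso_def by blast
qed

lemma tournament_arcs:
  assumes "tournament m T"
  shows "finite (pverts T)" "card (pverts T) = m" "pair_wf_digraph T"
    "\<And>x y. x \<in> pverts T \<Longrightarrow> y \<in> pverts T \<Longrightarrow> x \<noteq> y \<Longrightarrow> (x, y) \<in> parcs T \<or> (y, x) \<in> parcs T"
proof -
  obtain G where G: "complete_digraph m (with_proj G)" and T: "pair_digraph T"
    and sym: "mk_symmetric (with_proj T) = G"
    using assms unfolding tournament_def orientation_def by blast
  then have verts: "pverts T = pverts G" by auto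
  then show "finite (pverts T)" "card (pverts T) = m"
    using G by (auto simp: complete_digraph_pair_def)
  show "pair_wf_digraph T" using T by (simp add: pair_digraph.pair_wf_digraph)
  fix x y assume "x \<in> pverts T" "y \<in> pverts T" "x \<noteq> y"
  then have "(x, y) \<in> parcs G" using G verts by (auto simp: complete_digraph_pair_def)
  then show "(x, y) \<in> parcs T \<or> (y, x) \<in> parcs T"
    using sym by (auto simp: parcs_mk_symmetric_with_proj)
qed

theorem mainTheorem1:
  fixes D :: "'a pair_pre_digraph" and n k :: nat
  assumes "arborescence D"
    and "card (pverts D) = n"
    and "card (leaves D) = k"
  shows "unavoidable TYPE('t) (n + k - 1) D"
  unfolding unavoidable_def
proof (intro allI impI)
  fix T :: "'t pair_pre_digraph"
  assume "tournament (n + k - 1) T"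
  note T = tournament_arcs[OF this]
  have wf: "pair_wf_digraph D"
    using assms(1) unfolding arborescence_def in_arborescence_def out_arborescence_def
      oriented_tree_def orientation_def by (auto simp: pair_digraph.pair_wf_digraph)
  obtain r where "rooted_tree (pverts D) r (parcs D) \<or> rooted_tree (pverts D) r ((parcs D)\<inverse>)"
    using assms(1) by (rule arborescence_rooted_tree)
  then have "\<exists>f. inj_on f (pverts D) \<and> f ` pverts D \<subseteq> pverts T \<and>
    (\<forall>(u, v) \<in> parcs D. (f u, f v) \<in> parcs T)"
  proof
    assume tree: "rooted_tree (pverts D) r (parcs D)"
    have "card (pverts D) + card (rooted_tree.sinks (pverts D) (parcs D)) \<le> card (pverts T) + 1"
      using card_sinks_le_card_leaves[OF tree] assms(2,3) T(2) by simp
    then show ?thesis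
      by (rule rooted_tree.embeds_in_tournament[OF tree T(1)]) (rule T(4))
  next
    assume tree: "rooted_tree (pverts D) r ((parcs D)\<inverse>)"
    have "card (pverts D) + card (rooted_tree.sinks (pverts D) ((parcs D)\<inverse>))
        \<le> card (pverts T) + 1"
      using card_sinks_le_card_leaves[OF tree] assms(2,3) T(2) by simp
    \<comment> \<open>The arcs of both tree and tournament are reversed; any two distinct vertices
      stay joined by an arc.\<close>
    then have "\<exists>f. inj_on f (pverts D) \<and> f ` pverts D \<subseteq> pverts T \<and>
        (\<forall>(u, v) \<in> (parcs D)\<inverse>. (f u, f v) \<in> (parcs T)\<inverse>)"
      by (rule rooted_tree.embeds_in_tournament[OF tree T(1)]) (use T(4) in blast)
    then show ?thesis by fast
  qed
  then obtain f where "inj_on f (pverts D)" "f ` pverts D \<subseteq> pverts T"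
    "\<forall>(u, v) \<in> parcs D. (f u, f v) \<in> parcs T"
    by blast
  with T(3) wf show "contains_subdigraph T D" by (intro contains_subdigraphI[of T D f]) auto
qed

end
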